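(* Let $m>0$, $d>0$, let $\lambda_1,\dots,\lambda_{n-1}>0$, and for $k=1,\dots,n-1$ let $$h_k(s)=\frac{1}{ms^2+ds+\lambda_k},$$ with $h_k(t)$, $t\ge 0$, its inverse Laplace transform. Then for all $k,l\in\{1,\dots,n-1\}$, $$\langle h_k,h_l\rangle=\frac{2d}{m(\lambda_k-\lambda_l)^2+2(\lambda_k+\lambda_l)d^2}.$$
   Context: Here $\langle h_k,h_l\rangle:=\int_0^\infty h_k(t)h_l(t)\,dt$. In the application, $m$ and $d$ are the inertia and damping of a representative machine with swing dynamics $g_0(s)=\frac{1}{s(ms+d)}$, $\lambda_1\le\dots\le\lambda_{n-1}$ are the nonzero eigenvalues of a scaled network Laplacian, and $h_k=g_0/(1+\lambda_k g_0)$. *)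

theory Defs
  imports "HOL-Analysis.Analysis"
begin

definition laplace_transform :: "(real \<Rightarrow> real) \<Rightarrow> complex \<Rightarrow> complex" where
  "laplace_transform f s = (LBINT t:{0..}. exp (- s * of_real t) * of_real (f t))"

text \<open>
  An inverse Laplace transform is determined only almost everywhere on the half-line, hence
  a relation rather than a function. Values at negative times are irrelevant. The integrability
  conjunct is needed because the integral of a non-integrable function is 0 by convention.
\<close>

definition is_inverse_laplace :: "(real \<Rightarrow> real) \<Rightarrow> (complex \<Rightarrow> complex) \<Rightarrow> bool" where
  "is_inverse_laplace f F \<longleftrightarrow>
     (\<exists>c. \<forall>s. c < Re s \<longrightarrow>
        set_integrable lborel {0..} (\<lambda>t. exp (- s * of_real t) * of_real (f t)) \<and>
        laplace_transform f s = F s)"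

definition half_line_inner :: "(real \<Rightarrow> real) \<Rightarrow> (real \<Rightarrow> real) \<Rightarrow> real" where
  "half_line_inner f g = (LBINT t:{0..}. f t * g t)"

end

theory Submission
  imports Defs "HOL-Probability.Probability"
begin

text \<open>
  One inverse transform of \<open>1 / (m s\<^sup>2 + d s + l)\<close> is the exponentially decaying solution
  of \<open>m g'' + d g' + l g = 0\<close> with \<open>g 0 = 0\<close> and \<open>g' 0 = 1 / m\<close>; any other inverse transform
  agrees with it almost everywhere. Both the Laplace integral of \<open>g\<close> and the inner product of two
  such solutions have integrands with an antiderivative that is an explicit (bi)linear form in
  \<open>(g, g')\<close>, so only its value at 0 contributes, and beyond its decay no formula for \<open>g\<close> is needed.
\<close>

section \<open>Integration over the half-line\<close>

text \<open>The exponential bound makes \<open>f\<close> absolutely integrable, so its integral is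
  the limit of the integrals over \<open>{0..b}\<close>, to which the fundamental theorem
  applies.\<close>

lemma half_line_integral_FTC:
  fixes F f :: "real \<Rightarrow> 'a::euclidean_space" and a K :: real
  assumes F: "\<And>t. (F has_vector_derivative f t) (at t)"
    and cont: "continuous_on UNIV f"
    and "a > 0" and bound: "\<And>t. t \<ge> 0 \<Longrightarrow> norm (f t) \<le> K * exp (- a * t)"
    and lim: "(F \<longlongrightarrow> 0) at_top"
  shows "set_integrable lborel {0..} f" and "(LBINT t:{0..}. f t) = - F 0"
proof -
  have meas [measurable]: "f \<in> borel_measurable borel"
    using cont by (rule borel_measurable_continuous_onI)
  \<comment> \<open>The improper integral of the exponential yields integrability for
    \<open>lebesgue\<close>; Borel measurability transfers it to \<open>lborel\<close>.\<close>
  have "set_integrable lebesgue {0..} (\<lambda>t. exp (- a * t))"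
    using \<open>a > 0\<close> by (intro nonnegative_absolutely_integrable_1 integrable_on_exp_minus_to_infinity) auto
  then have "set_integrable lborel {0..} (\<lambda>t. exp (- a * t))"
    unfolding set_integrable_def by (subst (asm) integrable_completion) auto
  then have "set_integrable lborel {0..} (\<lambda>t. K * exp (- a * t))"
    by (rule set_integrable_mult_right)
  then show int: "set_integrable lborel {0..} f"
    by (rule set_integrable_bound)
      (use bound in \<open>auto simp: set_borel_measurable_def intro!: order.trans[OF bound]\<close>)
  have "((\<lambda>b. F b - F 0) \<longlongrightarrow> (LBINT t:{0..}. f t)) at_top"
  proof (rule Lim_transform_eventually)
    show "((\<lambda>b. LBINT t:{0..b}. f t) \<longlongrightarrow> (LBINT t:{0..}. f t)) at_top"
      using int by (intro tendsto_set_lebesgue_integral_at_top) auto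
    show "\<forall>\<^sub>F b in at_top. (LBINT t:{0..b}. f t) = F b - F 0"
      using eventually_ge_at_top[of 0]
    proof eventually_elim
      case (elim b)
      then show ?case
        unfolding set_lebesgue_integral_def
        by (intro integral_FTC_atLeastAtMost)
          (auto intro: has_vector_derivative_at_within[OF F] continuous_on_subset[OF cont])
    qed
  qed
  moreover have "((\<lambda>b. F b - F 0) \<longlongrightarrow> 0 - F 0) at_top"
    by (intro tendsto_intros lim)
  ultimately show "(LBINT t:{0..}. f t) = - F 0"
    using tendsto_unique[OF trivial_limit_at_top_linorder] by fastforce
qed

section \<open>Uniqueness of the inverse Laplace transform\<close>

text \<open>The positive and negative parts have the same Fourier transform, hence, once normalised to
  probability densities, they coincide by Levy's uniqueness theorem.\<close>

lemma AE_zero_if_fourier_transform_zero: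
  fixes u :: "real \<Rightarrow> real"
  assumes int: "integrable lborel u"
    and fourier: "\<And>w. (LBINT t. iexp (w * t) * of_real (u t)) = 0"
  shows "AE t in lborel. u t = 0"
proof -
  have [measurable]: "u \<in> borel_measurable borel"
    using int by (auto dest: borel_measurable_integrable)
  define pos neg where "pos t = max 0 (u t)" and "neg t = max 0 (- u t)" for t
  have [measurable]: "pos \<in> borel_measurable borel" "neg \<in> borel_measurable borel"
    unfolding pos_def neg_def by measurable
  have nonneg: "pos t \<ge> 0" "neg t \<ge> 0" for t
    by (simp_all add: pos_def neg_def)
  have ipos: "integrable lborel pos" and ineg: "integrable lborel neg"
    unfolding pos_def neg_def using int by auto
  have iexp_int: "integrable lborel (\<lambda>t. p t *\<^sub>R iexp (w * t))"
    if "integrable lborel p" for p :: "real \<Rightarrow> real" and w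
    by (rule Bochner_Integration.integrable_bound[OF that])
      (use borel_measurable_integrable[OF that] in \<open>auto simp: norm_exp_i_times simp del: of_real_mult\<close>)
  have same: "(LBINT t. pos t *\<^sub>R iexp (w * t)) = (LBINT t. neg t *\<^sub>R iexp (w * t))" for w
  proof -
    have "(LBINT t. pos t *\<^sub>R iexp (w * t)) - (LBINT t. neg t *\<^sub>R iexp (w * t))
        = (LBINT t. pos t *\<^sub>R iexp (w * t) - neg t *\<^sub>R iexp (w * t))"
      by (intro Bochner_Integration.integral_diff[symmetric] iexp_int ipos ineg)
    also have "\<dots> = (LBINT t. iexp (w * t) * of_real (u t))"
      by (intro Bochner_Integration.integral_cong)
        (auto simp: pos_def neg_def max_def scaleR_conv_of_real)
    finally show ?thesis
      using fourier by simp
  qed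
  define Z where "Z = (LBINT t. pos t)"
  \<comment> \<open>At frequency 0 the transform is the total mass, so both parts have the same mass
    \<open>Z\<close> and one normalisation serves both.\<close>
  have Z_neg: "(LBINT t. neg t) = Z"
    using same[of 0] by (simp add: Z_def scaleR_conv_of_real)
  have "Z \<ge> 0"
    unfolding Z_def by (rule Bochner_Integration.integral_nonneg) (rule nonneg)
  show ?thesis
  proof (cases "Z = 0")
    case True
    have "AE t in lborel. pos t = 0" "AE t in lborel. neg t = 0"
      using integral_nonneg_eq_0_iff_AE[OF ipos] integral_nonneg_eq_0_iff_AE[OF ineg]
        nonneg True Z_neg Z_def by simp_all
    then show ?thesis
      by eventually_elim (auto simp: pos_def neg_def max_def split: if_splits)
  next
    case False
    with \<open>Z \<ge> 0\<close> have "Z > 0" by simp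
    define D where "D p = density lborel (\<lambda>t. ennreal (p t / Z))" for p :: "real \<Rightarrow> real"
    have distr: "real_distribution (D p)"
      if "integrable lborel p" "\<And>t. p t \<ge> 0" "(LBINT t. p t) = Z" for p
    proof -
      have [measurable]: "p \<in> borel_measurable borel"
        using that(1) by (auto dest: borel_measurable_integrable)
      have "(\<integral>\<^sup>+ t. ennreal (p t / Z) \<partial>lborel) = ennreal (LBINT t. p t / Z)"
        using that \<open>Z > 0\<close> by (intro nn_integral_eq_integral) auto
      also have "\<dots> = 1"
        using that \<open>Z > 0\<close> by simp
      finally have "prob_space (D p)"
        by (intro prob_spaceI) (simp add: D_def emeasure_density)
      then show ?thesis
        by (simp add: real_distribution_def real_distribution_axioms_def D_def)
    qed
    have char_D: "char (D p) w = (LBINT t. p t *\<^sub>R iexp (w * t)) / Z"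
      if "integrable lborel p" "\<And>t. p t \<ge> 0" for p w
    proof -
      have [measurable]: "p \<in> borel_measurable borel"
        using that(1) by (auto dest: borel_measurable_integrable)
      have "char (D p) w = (LBINT t. (p t / Z) *\<^sub>R iexp (w * t))"
        unfolding char_def D_def using that \<open>Z > 0\<close> by (intro integral_density) auto
      also have "\<dots> = (LBINT t. p t *\<^sub>R iexp (w * t) / Z)"
        by (intro Bochner_Integration.integral_cong) (auto simp: scaleR_conv_of_real)
      finally show ?thesis by simp
    qed
    have "D pos = D neg"
      using ipos ineg Z_neg
      by (intro Levy_uniqueness distr ext)
        (auto simp: char_D same nonneg Z_def simp del: of_real_mult)
    then have "AE t in lborel. ennreal (pos t / Z) = ennreal (neg t / Z)"
      unfolding D_def by (intro sigma_finite_measure.density_unique[OF lborel.sigma_finite_measure_axioms]) auto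
    \<comment> \<open>At every point at most one of \<open>pos\<close> and \<open>neg\<close> is
      nonzero, so where they agree both vanish, and so does \<open>u\<close>.\<close>
    then show ?thesis
      by eventually_elim
        (use \<open>Z > 0\<close> in \<open>auto simp: pos_def neg_def max_def divide_less_0_iff split: if_splits\<close>)
  qed
qed

text \<open>Integrability of the kernel times \<open>f\<close> includes measurability, and
  multiplying by \<open>exp (s * t)\<close> undoes the kernel. Only the truncation of
  \<open>f\<close> is reached, since its values at negative times are arbitrary.\<close>

lemma measurable_half_line_if_laplace_integrable:
  assumes "set_integrable lborel {0..} (\<lambda>t. exp (- s * of_real t) * complex_of_real (f t))"
  shows "(\<lambda>t. indicator {0..} t * f t) \<in> borel_measurable borel"
proof -
  have "(\<lambda>t. indicator {0..} t *\<^sub>R (exp (- s * of_real t) * complex_of_real (f t)))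
      \<in> borel_measurable borel"
    using assms by (auto simp: set_integrable_def dest: borel_measurable_integrable)
  then have "(\<lambda>t. Re (exp (s * of_real t) *
      (indicator {0..} t *\<^sub>R (exp (- s * of_real t) * complex_of_real (f t))))) \<in> borel_measurable borel"
    by measurable
  also have "(\<lambda>t. Re (exp (s * of_real t) *
      (indicator {0..} t *\<^sub>R (exp (- s * of_real t) * complex_of_real (f t)))))
    = (\<lambda>t. indicator {0..} t * f t)"
    by (auto simp: fun_eq_iff indicator_def mult.assoc[symmetric] exp_add[symmetric] simp del: Re_exp)
  finally show ?thesis .
qed

lemma inverse_laplace_measurable:
  assumes "is_inverse_laplace f F"
  shows "(\<lambda>t. indicator {0..} t * f t) \<in> borel_measurable borel"
proof -
  obtain c where "\<And>s. c < Re s \<Longrightarrow>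
      set_integrable lborel {0..} (\<lambda>t. exp (- s * of_real t) * complex_of_real (f t))"
    using assms unfolding is_inverse_laplace_def by auto
  then show ?thesis
    by (rule measurable_half_line_if_laplace_integrable[of "of_real (c + 1)"]) simp
qed

text \<open>On a vertical line in the half-plane of convergence, the Laplace transform of the difference
  is the Fourier transform of an integrable function.\<close>

lemma inverse_laplace_unique:
  assumes "is_inverse_laplace f F" "is_inverse_laplace g F"
  shows "AE t in lborel. t \<ge> 0 \<longrightarrow> f t = g t"
proof -
  obtain cf cg where
    f: "\<And>s. cf < Re s \<Longrightarrow>
        set_integrable lborel {0..} (\<lambda>t. exp (- s * of_real t) * complex_of_real (f t))"
      "\<And>s. cf < Re s \<Longrightarrow> laplace_transform f s = F s" and
    g: "\<And>s. cg < Re s \<Longrightarrow>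
        set_integrable lborel {0..} (\<lambda>t. exp (- s * of_real t) * complex_of_real (g t))"
      "\<And>s. cg < Re s \<Longrightarrow> laplace_transform g s = F s"
    using assms unfolding is_inverse_laplace_def by blast
  \<comment> \<open>The abscissa \<open>c\<close> lies in both half-planes of convergence, and the
    damping \<open>exp (- c * t)\<close> makes the difference integrable.\<close>
  define c where "c = max cf cg + 1"
  define u where "u t = indicator {0..} t * (exp (- c * t) * (f t - g t))" for t
  \<comment> \<open>The point is \<open>c - i w\<close>: the minus sign turns the Laplace kernel
    into the damping times \<open>iexp (w * t)\<close>.\<close>
  have line: "(\<lambda>t. iexp (w * t) * of_real (u t)) = (\<lambda>t. indicator {0..} t *\<^sub>R
      (exp (- Complex c (- w) * of_real t) * of_real (f t)
       - exp (- Complex c (- w) * of_real t) * of_real (g t)))" for w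
  proof
    fix t
    have "- Complex c (- w) * of_real t = of_real (- c * t) + \<i> * of_real (w * t)"
      by (simp add: complex_eq_iff)
    then have "exp (- Complex c (- w) * of_real t) = of_real (exp (- c * t)) * iexp (w * t)"
      by (simp only: exp_add exp_of_real)
    then show "iexp (w * t) * of_real (u t) = indicator {0..} t *\<^sub>R
      (exp (- Complex c (- w) * of_real t) * of_real (f t)
       - exp (- Complex c (- w) * of_real t) * of_real (g t))"
      by (auto simp: u_def indicator_def algebra_simps)
  qed
  have ints: "set_integrable lborel {0..}
        (\<lambda>t. exp (- Complex c (- w) * of_real t) * complex_of_real (f t))"
      "set_integrable lborel {0..}
        (\<lambda>t. exp (- Complex c (- w) * of_real t) * complex_of_real (g t))" for w
    by (intro f g; simp add: c_def)+
  have fourier: "(LBINT t. iexp (w * t) * of_real (u t)) = 0" for w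
  proof -
    have "(LBINT t. iexp (w * t) * of_real (u t))
        = laplace_transform f (Complex c (- w)) - laplace_transform g (Complex c (- w))"
      unfolding line laplace_transform_def set_integral_diff(2)[OF ints, symmetric]
      by (simp add: set_lebesgue_integral_def)
    also have "\<dots> = 0"
      by (subst f(2) g(2); simp add: c_def)+
    finally show ?thesis .
  qed
  \<comment> \<open>At \<open>w = 0\<close> the oscillating factor is 1, which leaves
    \<open>u\<close> itself.\<close>
  have "integrable lborel (\<lambda>t. iexp (0 * t) * complex_of_real (u t))"
    unfolding line using set_integral_diff(1)[OF ints[of 0]] by (simp only: set_integrable_def)
  then have "integrable lborel u"
    by (simp add: complex_of_real_integrable_eq)
  then have "AE t in lborel. u t = 0"
    using fourier by (rule AE_zero_if_fourier_transform_zero)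
  then show ?thesis
    by eventually_elim (auto simp: u_def)
qed

section \<open>Existence and decay of impulse responses\<close>

text \<open>The second-order equation as a first-order system, with \<open>v\<close> as the
  velocity. A unit impulse at time 0 gives the velocity jump \<open>1 / m\<close>. The decay is
  included because it gives integrability and removes the boundary terms at infinity.\<close>

definition impulse_response ::
  "real \<Rightarrow> real \<Rightarrow> real \<Rightarrow> (real \<Rightarrow> real) \<Rightarrow> (real \<Rightarrow> real) \<Rightarrow> bool" where
  "impulse_response m d l g v \<longleftrightarrow>
     (\<forall>t. (g has_real_derivative v t) (at t)) \<and>
     (\<forall>t. (v has_real_derivative - (d * v t + l * g t) / m) (at t)) \<and>
     g 0 = 0 \<and> v 0 = 1 / m \<and>
     (\<exists>a K. a > 0 \<and> (\<forall>t\<ge>0. \<bar>g t\<bar> \<le> K * exp (- a * t) \<and> \<bar>v t\<bar> \<le> K * exp (- a * t)))"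

text \<open>The three cases are the overdamped, critically damped and underdamped regimes, after the
  factor \<open>exp (- a * t)\<close> has been split off.\<close>

lemma second_order_solution_exists:
  fixes a q :: real
  assumes "a > 0" "q < a\<^sup>2"
  shows "\<exists>S C b K. b < a \<and> S 0 = 0 \<and> C 0 = 1 \<and>
    (\<forall>t. (S has_real_derivative C t) (at t)) \<and> (\<forall>t. (C has_real_derivative q * S t) (at t)) \<and>
    (\<forall>t\<ge>0. \<bar>S t\<bar> \<le> K * exp (b * t) \<and> \<bar>C t\<bar> \<le> K * exp (b * t))"
proof -
  \<comment> \<open>\<open>S\<close> is a bounded profile divided by a frequency or rate
    \<open>w\<close>, while \<open>C\<close> is not divided; the constant \<open>1 + 1 / w\<close>
    covers both.\<close>
  have enlarge: "\<bar>x / w\<bar> \<le> (1 + 1 / w) * E" "\<bar>y\<bar> \<le> (1 + 1 / w) * E"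
    if "\<bar>x\<bar> \<le> E" "\<bar>y\<bar> \<le> E" "w > 0" for x y w E :: real
  proof -
    have "E \<ge> 0" using that(1) by linarith
    then have "E / w \<ge> 0" "\<bar>x\<bar> / w \<le> E / w"
      using that by (auto intro: divide_right_mono)
    then show "\<bar>x / w\<bar> \<le> (1 + 1 / w) * E" "\<bar>y\<bar> \<le> (1 + 1 / w) * E"
      unfolding distrib_right using that \<open>E \<ge> 0\<close> by (auto intro: add_increasing2)
  qed
  consider "q > 0" | "q = 0" | "q < 0" by linarith
  then show ?thesis
  proof cases
    case 1
    \<comment> \<open>Here \<open>S\<close> is \<open>sinh (w * t) / w\<close>, of growth rate
      \<open>w\<close>, and \<open>q < a\<^sup>2\<close> gives \<open>w < a\<close>.\<close>
    define w where "w = sqrt q"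
    have w: "w > 0" "w * w = q" "w < a"
      using 1 assms by (auto simp: w_def real_less_lsqrt)
    have half_bounds: "\<bar>(x - y) / 2\<bar> \<le> x" "\<bar>(x + y) / 2\<bar> \<le> x" if "0 < y" "y \<le> x" for x y :: real
      using that by (auto simp: abs_if)
    have b: "\<bar>sinh (w * t)\<bar> \<le> exp (w * t)" "\<bar>cosh (w * t)\<bar> \<le> exp (w * t)" if "t \<ge> 0" for t
    proof -
      have e: "0 < exp (- (w * t))" "exp (- (w * t)) \<le> exp (w * t)"
        using that w by auto
      show "\<bar>sinh (w * t)\<bar> \<le> exp (w * t)"
        unfolding sinh_field_def by (rule half_bounds(1)[OF e])
      show "\<bar>cosh (w * t)\<bar> \<le> exp (w * t)"
        unfolding cosh_field_def by (rule half_bounds(2)[OF e])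
    qed
    show ?thesis
    proof (intro exI conjI allI impI)
      show "\<bar>sinh (w * t) / w\<bar> \<le> (1 + 1 / w) * exp (w * t)"
        and "\<bar>cosh (w * t)\<bar> \<le> (1 + 1 / w) * exp (w * t)" if "t \<ge> 0" for t
        using enlarge[OF b[OF that] w(1)] by blast+
    qed (use w in \<open>auto intro!: derivative_eq_intros simp: field_simps\<close>)
  next
    case 2
    \<comment> \<open>Now \<open>S t = t\<close> and \<open>C t = 1\<close>. Linear growth is
      absorbed by the rate \<open>a / 2\<close>, which is positive and below \<open>a\<close>,
      through \<open>x \<le> exp x\<close>.\<close>
    have b: "\<bar>a / 2 * t\<bar> \<le> exp (a / 2 * t)" "\<bar>1\<bar> \<le> exp (a / 2 * t)" if "t \<ge> 0" for t
    proof -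
      have "a / 2 * t \<ge> 0" using assms that by simp
      then show "\<bar>a / 2 * t\<bar> \<le> exp (a / 2 * t)" "\<bar>1\<bar> \<le> exp (a / 2 * t)"
        using exp_ge_add_one_self[of "a / 2 * t"] by linarith+
    qed
    show ?thesis
    proof (intro exI conjI allI impI)
      show "\<bar>t\<bar> \<le> (1 + 1 / (a / 2)) * exp (a / 2 * t)"
        and "\<bar>1\<bar> \<le> (1 + 1 / (a / 2)) * exp (a / 2 * t)" if "t \<ge> 0" for t
        using enlarge[OF b[OF that], of "a / 2"] assms by auto
    qed (use assms 2 in \<open>auto intro!: derivative_eq_intros simp: field_simps\<close>)
  next
    case 3
    \<comment> \<open>The oscillating solutions \<open>sin (w * t) / w\<close> and
      \<open>cos (w * t)\<close> are bounded, so the rate 0 suffices.\<close>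
    define w where "w = sqrt (- q)"
    have w: "w > 0" "q = - (w * w)"
      using 3 by (auto simp: w_def)
    show ?thesis
    proof (intro exI conjI allI impI)
      show "\<bar>sin (w * t) / w\<bar> \<le> (1 + 1 / w) * exp (0 * t)"
        and "\<bar>cos (w * t)\<bar> \<le> (1 + 1 / w) * exp (0 * t)" for t
        using enlarge[OF _ _ w(1), of "sin (w * t)" "exp (0 * t)" "cos (w * t)"] by auto
      show "((\<lambda>t. cos (w * t)) has_real_derivative q * (sin (w * t) / w)) (at t)" for t
        unfolding w(2) using w(1) by (auto intro!: derivative_eq_intros simp: field_simps)
    qed (use w(1) assms in \<open>auto intro!: derivative_eq_intros simp: field_simps\<close>)
  qed
qed

text \<open>Splitting off \<open>exp (- a * t)\<close> with \<open>a = d / (2 * m)\<close> removes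
  the first-order term and leaves \<open>S'' = q * S\<close>. As \<open>l / m > 0\<close>,
  \<open>q\<close> is below \<open>a\<^sup>2\<close>, so \<open>S\<close> grows more slowly than the
  split-off factor decays.\<close>

lemma impulse_response_exists:
  assumes "m > 0" "d > 0" "l > 0"
  shows "\<exists>g v. impulse_response m d l g v"
proof -
  define a where "a = d / (2 * m)"
  define q where "q = a\<^sup>2 - l / m"
  have "a > 0" "q < a\<^sup>2"
    using assms by (auto simp: a_def q_def)
  then obtain S C b K where b: "b < a" and SC: "S 0 = 0" "C 0 = 1"
    and dS: "\<And>t. (S has_real_derivative C t) (at t)"
    and dC: "\<And>t. (C has_real_derivative q * S t) (at t)"
    and K: "\<And>t. t \<ge> 0 \<Longrightarrow> \<bar>S t\<bar> \<le> K * exp (b * t)" "\<And>t. t \<ge> 0 \<Longrightarrow> \<bar>C t\<bar> \<le> K * exp (b * t)"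
    using second_order_solution_exists[of a q] by metis
  define g where "g t = exp (- a * t) * S t / m" for t
  define v where "v t = exp (- a * t) * (C t - a * S t) / m" for t
  have "K \<ge> 0" using K(2)[of 0] by auto
  have "exp (- (a - b) * t) = exp (- a * t) * exp (b * t)" for t
    by (simp add: algebra_simps exp_add[symmetric])
  then have dec: "exp (- a * t) * ((1 + a) * (K * exp (b * t))) / m
      = ((1 + a) * K / m) * exp (- (a - b) * t)" for t
    by simp
  have "impulse_response m d l g v"
    unfolding impulse_response_def
  proof (intro conjI exI allI impI)
    show "(g has_real_derivative v t) (at t)" for t
      unfolding g_def v_def using assms
      by (auto intro!: derivative_eq_intros dS simp: field_simps)
    \<comment> \<open>Expressing \<open>d\<close> and \<open>l\<close> through \<open>a\<close>,
      \<open>q\<close> and \<open>m\<close> reduces the equation for \<open>v\<close> to an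
      algebraic identity.\<close>
    have dl: "d = 2 * a * m" "l = (a\<^sup>2 - q) * m"
      using assms by (auto simp: a_def q_def)
    show "(v has_real_derivative - (d * v t + l * g t) / m) (at t)" for t
      unfolding dl g_def v_def using \<open>m > 0\<close>
      by (auto intro!: derivative_eq_intros dS dC simp: field_simps power2_eq_square)
    show "a - b > 0" using b by simp
    fix t :: real assume t: "t \<ge> 0"
    let ?E = "exp (- a * t)" and ?B = "K * exp (b * t)"
    have "\<bar>g t\<bar> = ?E * \<bar>S t\<bar> / m"
      using assms by (simp add: g_def abs_mult)
    also have "\<dots> \<le> ?E * ((1 + a) * ?B) / m"
      using K[OF t] assms \<open>a > 0\<close> \<open>K \<ge> 0\<close>
      by (intro divide_right_mono mult_left_mono) (auto simp: distrib_right intro: add_increasing2)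
    finally show "\<bar>g t\<bar> \<le> ((1 + a) * K / m) * exp (- (a - b) * t)"
      unfolding dec .
    \<comment> \<open>The factor \<open>1 + a\<close> comes from the coefficients of
      \<open>C\<close> and \<open>S\<close> in \<open>v\<close>; it was also used for
      \<open>g\<close> so that one constant bounds both.\<close>
    have "\<bar>C t - a * S t\<bar> \<le> \<bar>C t\<bar> + a * \<bar>S t\<bar>"
      using \<open>a > 0\<close> abs_triangle_ineq4[of "C t" "a * S t"] by (simp add: abs_mult)
    also have "\<dots> \<le> (1 + a) * ?B"
      using K[OF t] \<open>a > 0\<close> by (auto simp: distrib_right intro!: add_mono mult_left_mono)
    finally have CS: "\<bar>C t - a * S t\<bar> \<le> (1 + a) * ?B" .
    have "\<bar>v t\<bar> = ?E * \<bar>C t - a * S t\<bar> / m"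
      using assms by (simp add: v_def abs_mult)
    also have "\<dots> \<le> ?E * ((1 + a) * ?B) / m"
      using CS assms by (intro divide_right_mono mult_left_mono) auto
    finally show "\<bar>v t\<bar> \<le> ((1 + a) * K / m) * exp (- (a - b) * t)"
      unfolding dec .
  qed (use SC assms in \<open>auto simp: g_def v_def\<close>)
  then show ?thesis by blast
qed

section \<open>Laplace transform of an impulse response\<close>

lemma tendsto_zero_if_exp_bound:
  fixes f :: "real \<Rightarrow> 'a::real_normed_vector"
  assumes "a > 0" "\<And>t. t \<ge> 0 \<Longrightarrow> norm (f t) \<le> K * exp (- a * t)"
  shows "(f \<longlongrightarrow> 0) at_top"
proof (rule Lim_null_comparison)
  show "\<forall>\<^sub>F t in at_top. norm (f t) \<le> K * exp (- a * t)"
    using eventually_ge_at_top[of 0] by eventually_elim (rule assms)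
  show "((\<lambda>t. K * exp (- a * t)) \<longlongrightarrow> 0) at_top"
    using \<open>a > 0\<close> by real_asymp
qed

text \<open>The differential equation makes the characteristic polynomial times the Laplace
  integrand an exact derivative. The initial data make its integral 1.\<close>

lemma impulse_response_laplace:
  assumes ir: "impulse_response m d l g v" and "m > 0"
  shows "is_inverse_laplace g (\<lambda>s. 1 / (of_real m * s ^ 2 + of_real d * s + of_real l))"
  unfolding is_inverse_laplace_def
proof (intro exI[of _ 0] allI impI conjI)
  fix s :: complex assume s: "0 < Re s"
  have dg: "(g has_real_derivative v t) (at t)"
    and dv: "(v has_real_derivative - (d * v t + l * g t) / m) (at t)" for t
    using ir by (auto simp: impulse_response_def)
  obtain a K where a: "a > 0" and K: "\<And>t. t \<ge> 0 \<Longrightarrow> \<bar>g t\<bar> \<le> K * exp (- a * t)"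
    "\<And>t. t \<ge> 0 \<Longrightarrow> \<bar>v t\<bar> \<le> K * exp (- a * t)"
    using ir unfolding impulse_response_def by blast
  let ?P = "of_real m * s ^ 2 + of_real d * s + of_real l"
  let ?f = "\<lambda>t. exp (- s * of_real t) * complex_of_real (g t)"
  \<comment> \<open>This is the boundary term left by integrating
    \<open>m g'' + d g' + l g = 0\<close> by parts against the kernel;
    \<open>- F 0 = m * v 0 = 1\<close>.\<close>
  define F where "F t = - (exp (- s * of_real t) * complex_of_real (m * v t)
    + (m * s + d) * (exp (- s * of_real t) * complex_of_real (g t)))" for t
  have bound: "norm (exp (- s * of_real t) * complex_of_real x) \<le> K * exp (- (Re s + a) * t)"
    if "t \<ge> 0" "\<bar>x\<bar> \<le> K * exp (- a * t)" for x K t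
  proof -
    have "norm (exp (- s * of_real t) * complex_of_real x) = exp (- Re s * t) * \<bar>x\<bar>"
      by (simp add: norm_mult)
    also have "\<dots> \<le> exp (- Re s * t) * (K * exp (- a * t))"
      using that by (intro mult_left_mono) auto
    also have "\<dots> = K * exp (- (Re s + a) * t)"
      by (simp add: algebra_simps exp_add[symmetric])
    finally show ?thesis .
  qed
  have pos: "Re s + a > 0" using s a by simp
  have lim_g: "(?f \<longlongrightarrow> 0) at_top"
    by (rule tendsto_zero_if_exp_bound[OF pos, where K = K]) (rule bound, use K in auto)
  have lim_v: "((\<lambda>t. exp (- s * of_real t) * complex_of_real (m * v t)) \<longlongrightarrow> 0) at_top"
    by (rule tendsto_zero_if_exp_bound[OF pos, where K = "m * K"])
      (rule bound, use K \<open>m > 0\<close> in \<open>auto simp: abs_mult\<close>)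
  have lim: "(F \<longlongrightarrow> 0) at_top"
    unfolding F_def by (rule tendsto_eq_intros lim_g lim_v refl | simp)+
  have "((\<lambda>t. m * v t) has_real_derivative - (d * v t + l * g t)) (at t)" for t
    using DERIV_cmult[OF dv, of m t] \<open>m > 0\<close> by simp
  note dgc = has_vector_derivative_of_real[where ?'a = complex, OF dg]
    and dvc = has_vector_derivative_of_real[where ?'a = complex, OF this]
  have dexp: "((\<lambda>t. exp (- s * of_real t)) has_vector_derivative - s * exp (- s * of_real t)) (at t)"
    for t
    by (rule derivative_eq_intros has_vector_derivative_real_field refl | simp)+
  have dF: "(F has_vector_derivative ?P * ?f t) (at t)" for t
    unfolding F_def
    by (rule derivative_eq_intros dexp dgc dvc refl)+ (simp add: algebra_simps power2_eq_square)
  have cont: "continuous_on UNIV (\<lambda>t. ?P * ?f t)"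
    by (intro continuous_intros) (meson DERIV_isCont continuous_at_imp_continuous_on dg)
  have bound_f: "norm (?P * ?f t) \<le> (norm ?P * K) * exp (- (Re s + a) * t)" if "t \<ge> 0" for t
    using mult_left_mono[OF bound[OF that K(1)[OF that]] norm_ge_zero[of ?P]]
    by (simp only: norm_mult mult.assoc)
  have int: "set_integrable lborel {0..} (\<lambda>t. ?P * ?f t)"
    and "(LBINT t:{0..}. ?P * ?f t) = - F 0"
    by (rule half_line_integral_FTC[OF dF cont pos bound_f lim]; assumption)+
  then have eq: "?P * laplace_transform g s = 1"
    using ir \<open>m > 0\<close> unfolding laplace_transform_def
    by (simp add: F_def impulse_response_def)
  \<comment> \<open>A product equal to 1 has no zero factor, so no root location is computed;
    cancelling \<open>?P\<close> gives both integrability and the value.\<close>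
  then have "?P \<noteq> 0" by auto
  then show "set_integrable lborel {0..} ?f"
    using int by (simp del: times_divide_eq_right)
  show "laplace_transform g s = 1 / ?P"
    using eq \<open>?P \<noteq> 0\<close> by (simp add: field_simps)
qed

section \<open>Inner products of impulse responses\<close>

text \<open>The antiderivative of the product is found by solving a linear system for a bilinear form
  in \<open>(g1, v1)\<close> and \<open>(g2, v2)\<close>.\<close>

lemma impulse_response_inner:
  assumes ir1: "impulse_response m d l1 g1 v1" and ir2: "impulse_response m d l2 g2 v2"
    and "m > 0" "d > 0" "l1 > 0" "l2 > 0"
  shows "half_line_inner g1 g2 = 2 * d / (m * (l1 - l2) ^ 2 + 2 * (l1 + l2) * d ^ 2)"
proof -
  have dg1: "(g1 has_real_derivative v1 t) (at t)"
    and dv1: "(v1 has_real_derivative - (d * v1 t + l1 * g1 t) / m) (at t)"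
    and dg2: "(g2 has_real_derivative v2 t) (at t)"
    and dv2: "(v2 has_real_derivative - (d * v2 t + l2 * g2 t) / m) (at t)" for t
    using ir1 ir2 by (auto simp: impulse_response_def)
  obtain a1 K1 where a1: "a1 > 0"
    and K1: "\<And>t. t \<ge> 0 \<Longrightarrow> \<bar>g1 t\<bar> \<le> K1 * exp (- a1 * t)"
      "\<And>t. t \<ge> 0 \<Longrightarrow> \<bar>v1 t\<bar> \<le> K1 * exp (- a1 * t)"
    using ir1 unfolding impulse_response_def by blast
  obtain a2 K2 where a2: "a2 > 0"
    and K2: "\<And>t. t \<ge> 0 \<Longrightarrow> \<bar>g2 t\<bar> \<le> K2 * exp (- a2 * t)"
      "\<And>t. t \<ge> 0 \<Longrightarrow> \<bar>v2 t\<bar> \<le> K2 * exp (- a2 * t)"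
    using ir2 unfolding impulse_response_def by blast
  have lims: "(g1 \<longlongrightarrow> 0) at_top" "(v1 \<longlongrightarrow> 0) at_top" "(g2 \<longlongrightarrow> 0) at_top" "(v2 \<longlongrightarrow> 0) at_top"
    using tendsto_zero_if_exp_bound[OF a1, of g1 K1] tendsto_zero_if_exp_bound[OF a1, of v1 K1]
      tendsto_zero_if_exp_bound[OF a2, of g2 K2] tendsto_zero_if_exp_bound[OF a2, of v2 K2] K1 K2
    by auto
  define den where "den = m * (l1 - l2) ^ 2 + 2 * (l1 + l2) * d ^ 2"
  have "den > 0"
    using assms(3-) unfolding den_def by (intro add_nonneg_pos) auto
  \<comment> \<open>The coefficients make the \<open>g1 * v2\<close>, \<open>v1 * g2\<close> and
    \<open>v1 * v2\<close> terms of the derivative cancel, leaving \<open>- den * (g1 * g2)\<close>.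
    At 0 only \<open>v1 * v2 = 1 / m\<^sup>2\<close> survives, so
    \<open>Q 0 = 2 * d\<close>.\<close>
  define Q where "Q t = (2 * d ^ 3 + d * m * (l1 + l2)) * (g1 t * g2 t)
    + (2 * d\<^sup>2 * m + m\<^sup>2 * (l2 - l1)) * (g1 t * v2 t)
    + (2 * d\<^sup>2 * m - m\<^sup>2 * (l2 - l1)) * (v1 t * g2 t) + 2 * d * m\<^sup>2 * (v1 t * v2 t)" for t
  have dQ: "((\<lambda>t. - Q t / den) has_vector_derivative g1 t * g2 t) (at t)" for t
  proof -
    have "(Q has_real_derivative - den * (g1 t * g2 t)) (at t)"
      unfolding Q_def den_def
      by (rule derivative_eq_intros dg1 dg2 dv1 dv2 refl)+
        (use \<open>m > 0\<close> in \<open>simp add: field_simps power2_eq_square power3_eq_cube\<close>)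
    then have "((\<lambda>t. - Q t / den) has_real_derivative - (- den * (g1 t * g2 t)) / den) (at t)"
      by (intro DERIV_cdivide DERIV_minus)
    then show ?thesis
      using \<open>den > 0\<close> by (simp add: has_real_derivative_iff_has_vector_derivative)
  qed
  have "(Q \<longlongrightarrow> 0) at_top"
    unfolding Q_def by (rule tendsto_eq_intros lims refl | simp)+
  then have lim: "((\<lambda>t. - Q t / den) \<longlongrightarrow> 0) at_top"
    by (auto intro!: tendsto_eq_intros simp: \<open>den > 0\<close>[THEN less_imp_neq, symmetric])
  have cont: "continuous_on UNIV (\<lambda>t. g1 t * g2 t)"
    by (intro continuous_intros) (meson DERIV_isCont continuous_at_imp_continuous_on dg1 dg2)+
  have bound: "norm (g1 t * g2 t) \<le> (K1 * K2) * exp (- (a1 + a2) * t)" if "t \<ge> 0" for t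
  proof -
    have "\<bar>g1 t\<bar> * \<bar>g2 t\<bar> \<le> (K1 * exp (- a1 * t)) * (K2 * exp (- a2 * t))"
      using K1(1)[OF that] K2(1)[OF that] by (intro mult_mono) auto
    then show ?thesis
      by (simp add: abs_mult algebra_simps exp_add[symmetric])
  qed
  have "half_line_inner g1 g2 = - (- Q 0 / den)"
    unfolding half_line_inner_def using a1 a2
    by (intro half_line_integral_FTC(2)[OF dQ cont _ bound lim]) auto
  also have "\<dots> = 2 * d / den"
    using ir1 ir2 \<open>m > 0\<close> by (simp add: Q_def impulse_response_def power2_eq_square)
  finally show ?thesis
    by (simp add: den_def)
qed

text \<open>Inverse transforms of the same function agree almost everywhere on the half-line, which
  the integral cannot detect. This lets an arbitrary inverse transform be replaced by the impulse
  response.\<close>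

lemma half_line_inner_cong:
  assumes "is_inverse_laplace f F" "is_inverse_laplace f' F"
    and "is_inverse_laplace g G" "is_inverse_laplace g' G"
  shows "half_line_inner f g = half_line_inner f' g'"
proof -
  \<comment> \<open>The indicator is idempotent, so each factor can carry its own copy;
    measurability is known only for these truncated factors.\<close>
  have ind: "(LBINT t:{0..}. p t * q t) = (LBINT t. (indicator {0..} t * p t) * (indicator {0..} t * q t))"
    for p q :: "real \<Rightarrow> real"
    unfolding set_lebesgue_integral_def by (auto intro!: Bochner_Integration.integral_cong simp: indicator_def)
  note [measurable] = assms[THEN inverse_laplace_measurable]
  show ?thesis
    unfolding half_line_inner_def ind
  proof (rule integral_cong_AE)
    show "AE t in lborel. indicator {0..} t * f t * (indicator {0..} t * g t) =
        indicator {0..} t * f' t * (indicator {0..} t * g' t)"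
      using inverse_laplace_unique[OF assms(1,2)] inverse_laplace_unique[OF assms(3,4)]
      by eventually_elim (auto simp: indicator_def)
  qed measurable
qed

theorem proposition2:
  fixes m d :: real and n :: nat and lam :: "nat \<Rightarrow> real"
    and h :: "nat \<Rightarrow> real \<Rightarrow> real"
  assumes "m > 0" and "d > 0"
    and "\<And>k. k \<in> {1..n - 1} \<Longrightarrow> lam k > 0"
    and "\<And>k. k \<in> {1..n - 1} \<Longrightarrow>
           is_inverse_laplace (h k)
             (\<lambda>s. 1 / (of_real m * s ^ 2 + of_real d * s + of_real (lam k)))"
  shows "\<forall>k \<in> {1..n - 1}. \<forall>l \<in> {1..n - 1}.
           half_line_inner (h k) (h l) =
             2 * d / (m * (lam k - lam l) ^ 2 + 2 * (lam k + lam l) * d ^ 2)"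
proof (intro ballI)
  fix k l assume kl: "k \<in> {1..n - 1}" "l \<in> {1..n - 1}"
  obtain gk vk gl vl where ir: "impulse_response m d (lam k) gk vk"
    "impulse_response m d (lam l) gl vl"
    using impulse_response_exists[OF assms(1,2) assms(3)[OF kl(1)]]
      impulse_response_exists[OF assms(1,2) assms(3)[OF kl(2)]] by blast
  have "half_line_inner (h k) (h l) = half_line_inner gk gl"
    by (rule half_line_inner_cong[OF
          assms(4)[OF kl(1)] impulse_response_laplace[OF ir(1) assms(1)]
          assms(4)[OF kl(2)] impulse_response_laplace[OF ir(2) assms(1)]])
  also have "\<dots> = 2 * d / (m * (lam k - lam l) ^ 2 + 2 * (lam k + lam l) * d ^ 2)"
    by (rule impulse_response_inner[OF ir assms(1,2) assms(3)[OF kl(1)] assms(3)[OF kl(2)]])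
  finally show "half_line_inner (h k) (h l) =
      2 * d / (m * (lam k - lam l) ^ 2 + 2 * (lam k + lam l) * d ^ 2)" .
qed

end
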